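(* If $X$ is a quasi-Polish space, then the upper powerspace $\mathbf{K}(X)$ is quasi-Polish.
   Context: A subset $A$ of a topological space $Y$ is a $\mathbf{\Pi}^0_2$-subset if there are sequences $(U_i)_{i\in\omega}$ and $(V_i)_{i\in\omega}$ of open subsets of $Y$ such that $x\in A$ if and only if for all $i\in\omega$, $x\in U_i$ implies $x\in V_i$. A topological space is quasi-Polish if it is countably based and its topology is induced by a Smyth-complete quasi-metric; equivalently, if it is homeomorphic to a $\mathbf{\Pi}^0_2$-subset of an $\omega$-algebraic domain with the Scott topology (one may always take the domain to be $\mathcal{P}(\omega)$, the powerset of $\omega$ ordered by inclusion, with the Scott topology). Compactness means every open cover has a finite subcover (no separation axiom). A subset of a space is saturated if it equals the intersection of all its open neighborhoods. The upper powerspace $\mathbf{K}(X)$ is the set of all compact saturated subsets of $X$ (including $\emptyset$) with the upper Vietoris topology, which is generated by the sets $\Box U=\{K\in\mathbf{K}(X)\mid K\subseteq U\}$ for $U\subseteq X$ open. *)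

theory Defs
  imports "HOL-Analysis.Analysis"
begin

locale Quasi_metric_space =
  fixes M :: "'a set" and d :: "'a \<Rightarrow> 'a \<Rightarrow> real"
  assumes nonneg: "\<And>x y. 0 \<le> d x y"
  assumes zero: "\<And>x y. \<lbrakk>x \<in> M; y \<in> M\<rbrakk> \<Longrightarrow> d x y = 0 \<and> d y x = 0 \<longleftrightarrow> x = y"
  assumes triangle: "\<And>x y z. \<lbrakk>x \<in> M; y \<in> M; z \<in> M\<rbrakk> \<Longrightarrow> d x z \<le> d x y + d y z"
begin

definition qball :: "'a \<Rightarrow> real \<Rightarrow> 'a set"
  where "qball x r = {y. x \<in> M \<and> y \<in> M \<and> d x y < r}"

definition qtopology :: "'a topology"
  where "qtopology = topology (\<lambda>U. U \<subseteq> M \<and> (\<forall>x\<in>U. \<exists>r>0. qball x r \<subseteq> U))"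

definition sym_dist :: "'a \<Rightarrow> 'a \<Rightarrow> real"
  where "sym_dist x y = max (d x y) (d y x)"

text \<open>The order of the arguments of \<^term>\<open>d\<close> matters: it is the earlier term of the sequence that
  comes first, matching the balls used for the topology.\<close>

definition qCauchy :: "(nat \<Rightarrow> 'a) \<Rightarrow> bool"
  where "qCauchy \<sigma> \<longleftrightarrow> range \<sigma> \<subseteq> M \<and> (\<forall>\<epsilon>>0. \<exists>N. \<forall>n m. N \<le> n \<longrightarrow> n \<le> m \<longrightarrow> d (\<sigma> n) (\<sigma> m) < \<epsilon>)"

text \<open>Smyth-completeness asks for convergence in the metric topology of the symmetrization, not
  merely in \<^term>\<open>qtopology\<close>.\<close>

definition Smyth_complete :: bool
  where "Smyth_complete \<longleftrightarrow>
    (\<forall>\<sigma>. qCauchy \<sigma> \<longrightarrow> (\<exists>x. limitin (Metric_space.mtopology M sym_dist) \<sigma> x sequentially))"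

lemma openin_qtopology:
  "openin qtopology U \<longleftrightarrow> U \<subseteq> M \<and> (\<forall>x\<in>U. \<exists>r>0. qball x r \<subseteq> U)"
proof -
  have "istopology (\<lambda>U. U \<subseteq> M \<and> (\<forall>x\<in>U. \<exists>r>0. qball x r \<subseteq> U))"
    unfolding istopology_def
  proof (rule conjI; intro allI impI)
    fix S T
    assume S: "S \<subseteq> M \<and> (\<forall>x\<in>S. \<exists>r>0. qball x r \<subseteq> S)"
      and T: "T \<subseteq> M \<and> (\<forall>x\<in>T. \<exists>r>0. qball x r \<subseteq> T)"
    have "\<exists>r>0. qball x r \<subseteq> S \<inter> T" if x: "x \<in> S \<inter> T" for x
    proof -
      obtain r where r: "r > 0" "qball x r \<subseteq> S" using S x by blast
      obtain s where s: "s > 0" "qball x s \<subseteq> T" using T x by blast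
      have "qball x (min r s) \<subseteq> qball x r" "qball x (min r s) \<subseteq> qball x s"
        by (auto simp: qball_def)
      then show ?thesis
        using r s by (intro exI [of _ "min r s"]) auto
    qed
    then show "S \<inter> T \<subseteq> M \<and> (\<forall>x\<in>S \<inter> T. \<exists>r>0. qball x r \<subseteq> S \<inter> T)"
      using S by blast
  next
    fix \<K>
    assume "\<forall>K\<in>\<K>. K \<subseteq> M \<and> (\<forall>x\<in>K. \<exists>r>0. qball x r \<subseteq> K)"
    then show "\<Union>\<K> \<subseteq> M \<and> (\<forall>x\<in>\<Union>\<K>. \<exists>r>0. qball x r \<subseteq> \<Union>\<K>)"
      by (meson Sup_least Union_iff Union_upper order_trans)
  qed
  then show ?thesis
    by (simp add: qtopology_def topology_inverse')
qed

lemma topspace_qtopology [simp]: "topspace qtopology = M"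
proof
  show "topspace qtopology \<subseteq> M"
    using openin_qtopology openin_topspace by blast
  have "openin qtopology M"
    unfolding openin_qtopology qball_def by (auto intro: exI [of _ 1])
  then show "M \<subseteq> topspace qtopology"
    by (rule openin_subset)
qed

lemma Metric_space_sym_dist: "Metric_space M sym_dist"
proof
  fix x y z
  show "0 \<le> sym_dist x y" "sym_dist x y = sym_dist y x"
    using nonneg by (auto simp: sym_dist_def max_def)
  show "sym_dist x y = 0 \<longleftrightarrow> x = y" if "x \<in> M" "y \<in> M"
    using zero [OF that] nonneg [of x y] nonneg [of y x]
    by (auto simp: sym_dist_def max_def split: if_splits)
  show "sym_dist x z \<le> sym_dist x y + sym_dist y z" if "x \<in> M" "y \<in> M" "z \<in> M"
    using triangle [of x y z] triangle [of z y x] that by (auto simp: sym_dist_def max_def)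
qed

end

definition quasi_Polish_space :: "'a topology \<Rightarrow> bool"
  where "quasi_Polish_space X \<longleftrightarrow>
    second_countable X \<and>
    (\<exists>d. Quasi_metric_space (topspace X) d \<and>
         Quasi_metric_space.qtopology (topspace X) d = X \<and>
         Quasi_metric_space.Smyth_complete (topspace X) d)"

text \<open>The meet with \<^term>\<open>topspace X\<close> is vacuous for subsets of the space, the whole space being an
  open neighbourhood.\<close>

definition saturatedin :: "'a topology \<Rightarrow> 'a set \<Rightarrow> bool"
  where "saturatedin X S \<longleftrightarrow> S = topspace X \<inter> \<Inter>{U. openin X U \<and> S \<subseteq> U}"

definition compact_saturated_sets :: "'a topology \<Rightarrow> 'a set set"
  where "compact_saturated_sets X = {K. compactin X K \<and> saturatedin X K}"

definition upper_powerspace :: "'a topology \<Rightarrow> 'a set topology"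
  where "upper_powerspace X =
    topology_generated_by {{K \<in> compact_saturated_sets X. K \<subseteq> U} | U. openin X U}"

lemma topspace_upper_powerspace [simp]:
  "topspace (upper_powerspace X) = compact_saturated_sets X"
proof -
  have "K \<subseteq> topspace X" if "K \<in> compact_saturated_sets X" for K
    using that by (auto simp: compact_saturated_sets_def dest: compactin_subset_topspace)
  then show ?thesis
    unfolding upper_powerspace_def topology_generated_by_topspace by blast
qed

end

theory Submission
  imports Defs
begin

text \<open>The topology of \<open>\<^bold>K(X)\<close> is induced by the upper Hausdorff quasi-metric, for which \<open>L\<close> is within
  \<open>r\<close> of \<open>K\<close> if \<open>L\<close> lies in the \<open>r\<close>-enlargement of \<open>K\<close>; this uses only compactness. For
  Smyth-completeness, pass to a subsequence in which \<open>K\<^sub>m\<close> lies in the \<open>2\<^sup>-\<^sup>n\<close>-enlargement of \<open>K\<^sub>n\<close>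
  for \<open>n \<le> m\<close>, choose finite \<open>2\<^sup>-\<^sup>n\<close>-nets \<open>F\<^sub>n \<subseteq> K\<^sub>n\<close>, and let \<open>K\<close> be the intersection of the
  \<open>5\<cdot>2\<^sup>-\<^sup>n\<close>-enlargements of the \<open>F\<^sub>n\<close>. If increasing open sets \<open>W\<^sub>n\<close> cover \<open>K\<close>, then some \<open>W\<^sub>n\<close> already
  contains the \<open>n\<close>-th enlargement: otherwise points witnessing the failure are joined to \<open>F\<^sub>0\<close> by
  chains through the finite sets \<open>F\<^sub>i\<close>, Koenig's lemma gives an infinite chain, and its limit in the
  symmetrized metric is a point of \<open>K\<close> outside all \<open>W\<^sub>n\<close>. This yields both the compactness of \<open>K\<close>
  and the convergence of \<open>K\<^sub>n\<close> to \<open>K\<close>.\<close>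

section \<open>The upper Vietoris topology and its countable base\<close>

text \<open>The generating boxes are closed under finite intersections, since lying in
  \<open>U\<close> and in \<open>V\<close> means lying in \<open>U \<inter> V\<close>. They
  therefore form a base, and one box around each member decides openness.\<close>

lemma openin_upper_powerspace:
  "openin (upper_powerspace X) S \<longleftrightarrow>
    S \<subseteq> compact_saturated_sets X \<and>
    (\<forall>K\<in>S. \<exists>U. openin X U \<and> K \<subseteq> U \<and> {L \<in> compact_saturated_sets X. L \<subseteq> U} \<subseteq> S)"
    (is "_ \<longleftrightarrow> ?rhs S")
proof
  let ?G = "{{K \<in> compact_saturated_sets X. K \<subseteq> U} | U. openin X U}"
  assume "openin (upper_powerspace X) S"
  then have "generate_topology_on ?G S"
    by (simp add: upper_powerspace_def openin_topology_generated_by_iff)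
  then show "?rhs S"
  proof induction
    case (Int a b)
    show ?case
    proof (intro conjI ballI)
      fix K assume K: "K \<in> a \<inter> b"
      then obtain U V where "openin X U" "K \<subseteq> U" "{L \<in> compact_saturated_sets X. L \<subseteq> U} \<subseteq> a"
        "openin X V" "K \<subseteq> V" "{L \<in> compact_saturated_sets X. L \<subseteq> V} \<subseteq> b"
        using Int.IH by (meson IntD1 IntD2)
      then show "\<exists>U. openin X U \<and> K \<subseteq> U \<and> {L \<in> compact_saturated_sets X. L \<subseteq> U} \<subseteq> a \<inter> b"
        by (intro exI [of _ "U \<inter> V"]) auto
    qed (use Int.IH in auto)
  next
    case (UN \<K>)
    then show ?case by (meson Union_iff Union_upper Union_least order_trans)
  qed auto
next
  assume S: "?rhs S"
  show "openin (upper_powerspace X) S"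
  proof (subst openin_subopen, rule ballI)
    fix K assume "K \<in> S"
    then obtain U where U: "openin X U" "K \<subseteq> U" "{L \<in> compact_saturated_sets X. L \<subseteq> U} \<subseteq> S"
      using S by meson
    have "openin (upper_powerspace X) {L \<in> compact_saturated_sets X. L \<subseteq> U}"
      unfolding upper_powerspace_def using U(1) by (intro topology_generated_by_Basis) auto
    with U \<open>K \<in> S\<close> S show "\<exists>T. openin (upper_powerspace X) T \<and> K \<in> T \<and> T \<subseteq> S"
      by (intro exI [of _ "{L \<in> compact_saturated_sets X. L \<subseteq> U}"]) auto
  qed
qed

lemma openin_upper_powerspace_box:
  "openin X U \<Longrightarrow> openin (upper_powerspace X) {K \<in> compact_saturated_sets X. K \<subseteq> U}"
  by (subst openin_upper_powerspace) auto

lemma compact_saturated_sets_subset_topspace: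
  "K \<in> compact_saturated_sets X \<Longrightarrow> K \<subseteq> topspace X"
  by (auto simp: compact_saturated_sets_def dest: compactin_subset_topspace)

lemma saturatedin_subset:
  assumes "saturatedin X K" "L \<subseteq> topspace X" "\<And>U. openin X U \<Longrightarrow> K \<subseteq> U \<Longrightarrow> L \<subseteq> U"
  shows "L \<subseteq> K"
  using assms unfolding saturatedin_def by blast

text \<open>Each member of the family is itself an open neighbourhood of the intersection.
  Nonemptiness keeps the intersection inside the space, because the empty intersection is
  \<open>UNIV\<close>.\<close>

lemma saturatedin_Inter:
  assumes "\<And>U. U \<in> \<U> \<Longrightarrow> openin X U" "\<U> \<noteq> {}"
  shows "saturatedin X (\<Inter>\<U>)"
proof -
  have "\<Inter>\<U> \<subseteq> topspace X"
    using assms openin_subset by fastforce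
  then show ?thesis
    unfolding saturatedin_def using assms(1) by blast
qed

text \<open>Boxes over finite unions of base members suffice: if a compact \<open>K\<close> lies in
  an open \<open>U\<close>, finitely many base members inside \<open>U\<close> cover
  \<open>K\<close>, and their union lies between \<open>K\<close> and \<open>U\<close>.\<close>

lemma second_countable_upper_powerspace:
  assumes "second_countable X"
  shows "second_countable (upper_powerspace X)"
proof -
  obtain \<B> where \<B>: "countable \<B>" "\<And>V. V \<in> \<B> \<Longrightarrow> openin X V"
    "\<And>U x. openin X U \<Longrightarrow> x \<in> U \<Longrightarrow> \<exists>V\<in>\<B>. x \<in> V \<and> V \<subseteq> U"
    using assms unfolding second_countable_def by metis
  define box where "box U = {K \<in> compact_saturated_sets X. K \<subseteq> U}" for U
  define \<C> where "\<C> = (\<lambda>\<F>. box (\<Union>\<F>)) ` {\<F>. finite \<F> \<and> \<F> \<subseteq> \<B>}"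
  have "countable \<C>"
    unfolding \<C>_def using \<B>(1) by (intro countable_image countable_Collect_finite_subset)
  moreover have "openin (upper_powerspace X) V" if "V \<in> \<C>" for V
    using that \<B>(2) by (auto simp: \<C>_def box_def intro!: openin_upper_powerspace_box)
  moreover have "\<exists>V\<in>\<C>. K \<in> V \<and> V \<subseteq> S" if S: "openin (upper_powerspace X) S" "K \<in> S" for S K
  proof -
    obtain U where U: "openin X U" "K \<subseteq> U" "box U \<subseteq> S"
      using S unfolding openin_upper_powerspace box_def by meson
    have K: "K \<in> compact_saturated_sets X"
      using S openin_subset by fastforce
    then have "compactin X K"
      by (simp add: compact_saturated_sets_def)
    moreover have "K \<subseteq> \<Union>{V \<in> \<B>. V \<subseteq> U}"
      using \<B>(3) U by blast
    ultimately obtain \<F> where \<F>: "finite \<F>" "\<F> \<subseteq> {V \<in> \<B>. V \<subseteq> U}" "K \<subseteq> \<Union>\<F>"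
      using \<B>(2) compactinD [of X K "{V \<in> \<B>. V \<subseteq> U}"] by blast
    have "box (\<Union>\<F>) \<in> \<C>"
      using \<F> by (auto simp: \<C>_def)
    moreover have "K \<in> box (\<Union>\<F>)"
      using K \<F> by (simp add: box_def)
    moreover have "box (\<Union>\<F>) \<subseteq> S"
    proof -
      have "\<Union>\<F> \<subseteq> U"
        using \<F>(2) by blast
      then have "box (\<Union>\<F>) \<subseteq> box U"
        by (auto simp: box_def)
      with U(3) show ?thesis by blast
    qed
    ultimately show ?thesis by blast
  qed
  ultimately show ?thesis
    unfolding second_countable_def by (intro exI [of _ \<C>]) auto
qed

lemma eventually_half_power_less:
  fixes C \<epsilon> :: real
  assumes "0 < \<epsilon>"
  shows "\<forall>\<^sub>F n in sequentially. C * (1/2) ^ n < \<epsilon>"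
proof (rule order_tendstoD(2))
  show "(\<lambda>n. C * (1/2) ^ n) \<longlonglongrightarrow> C * 0"
    by (intro tendsto_intros LIMSEQ_power_zero) auto
qed (simp add: assms)

section \<open>Enlargements of sets in a quasi-metric space\<close>

context Quasi_metric_space
begin

lemma refl: "x \<in> M \<Longrightarrow> d x x = 0"
  using zero by blast

lemma openin_qball: "openin qtopology (qball x r)"
  unfolding openin_qtopology
proof (intro conjI ballI)
  fix y assume y: "y \<in> qball x r"
  have "qball y (r - d x y) \<subseteq> qball x r"
    using y triangle [of x y] by (fastforce simp: qball_def)
  then show "\<exists>s>0. qball y s \<subseteq> qball x r"
    using y by (intro exI [of _ "r - d x y"]) (auto simp: qball_def)
qed (auto simp: qball_def)

text \<open>Distances run from the points of \<open>K\<close> outwards, as in \<open>qball\<close>,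
  which makes every enlargement open.\<close>

definition enlarge :: "'a set \<Rightarrow> real \<Rightarrow> 'a set"
  where "enlarge K r = (\<Union>x\<in>K. qball x r)"

lemma mem_enlarge: "y \<in> enlarge K r \<longleftrightarrow> (\<exists>x\<in>K. x \<in> M \<and> y \<in> M \<and> d x y < r)"
  by (auto simp: enlarge_def qball_def)

lemma openin_enlarge: "openin qtopology (enlarge K r)"
  unfolding enlarge_def by (intro openin_Union) (auto simp: openin_qball)

lemma subset_enlarge: "K \<subseteq> M \<Longrightarrow> 0 < r \<Longrightarrow> K \<subseteq> enlarge K r"
  using refl by (force simp: mem_enlarge)

lemma enlarge_mono: "K \<subseteq> L \<Longrightarrow> r \<le> s \<Longrightarrow> enlarge K r \<subseteq> enlarge L s"
  by (force simp: mem_enlarge)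

lemma enlarge_enlarge: "enlarge (enlarge K r) s \<subseteq> enlarge K (r + s)"
proof
  fix z assume "z \<in> enlarge (enlarge K r) s"
  then obtain x y where "x \<in> K" "x \<in> M" "y \<in> M" "z \<in> M" "d x y < r" "d y z < s"
    by (auto simp: mem_enlarge)
  moreover from this have "d x z < r + s"
    using triangle [of x y z] by linarith
  ultimately show "z \<in> enlarge K (r + s)"
    by (auto simp: mem_enlarge)
qed

lemma compactin_finite_net:
  assumes "compactin qtopology K" "0 < r"
  obtains F where "finite F" "F \<subseteq> K" "K \<subseteq> enlarge F r"
proof -
  have "K \<subseteq> \<Union>((\<lambda>x. qball x r) ` K)"
    using subset_enlarge [of K r] compactin_subset_topspace [OF assms(1)] assms(2)
    by (simp add: enlarge_def)
  then obtain \<F> where "finite \<F>" "\<F> \<subseteq> (\<lambda>x. qball x r) ` K" "K \<subseteq> \<Union>\<F>"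
    using compactinD [OF assms(1), of "(\<lambda>x. qball x r) ` K"] openin_qball by blast
  then obtain F where "finite F" "F \<subseteq> K" "\<F> = (\<lambda>x. qball x r) ` F"
    by (meson finite_subset_image)
  with \<open>K \<subseteq> \<Union>\<F>\<close> that show thesis
    by (simp add: enlarge_def)
qed

text \<open>A Lebesgue number argument. Around each point of \<open>K\<close> a ball of radius
  \<open>2 * \<rho> x\<close> fits into \<open>U\<close>; finitely many balls of half that radius
  cover \<open>K\<close>, and the other half leaves room for a uniform \<open>r\<close>.\<close>

lemma compactin_enlarge_subset:
  assumes K: "compactin qtopology K" and U: "openin qtopology U" "K \<subseteq> U"
  obtains r where "0 < r" "enlarge K r \<subseteq> U"
proof -
  have KM: "K \<subseteq> M"
    using compactin_subset_topspace [OF K] by simp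
  have "\<exists>r>0. qball x (2 * r) \<subseteq> U" if x: "x \<in> K" for x
  proof -
    obtain s where "s > 0" "qball x s \<subseteq> U"
      using U x unfolding openin_qtopology by (meson subsetD)
    then show ?thesis by (intro exI [of _ "s / 2"]) auto
  qed
  then obtain \<rho> where \<rho>: "\<And>x. x \<in> K \<Longrightarrow> \<rho> x > 0" "\<And>x. x \<in> K \<Longrightarrow> qball x (2 * \<rho> x) \<subseteq> U"
    by metis
  have "K \<subseteq> \<Union>((\<lambda>x. qball x (\<rho> x)) ` K)"
    using KM \<rho>(1) refl by (force simp: qball_def)
  then obtain \<F> where "finite \<F>" "\<F> \<subseteq> (\<lambda>x. qball x (\<rho> x)) ` K" "K \<subseteq> \<Union>\<F>"
    using compactinD [OF K, of "(\<lambda>x. qball x (\<rho> x)) ` K"] openin_qball by blast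
  then obtain F where F: "finite F" "F \<subseteq> K" "\<F> = (\<lambda>x. qball x (\<rho> x)) ` F"
    by (meson finite_subset_image)
  with \<open>K \<subseteq> \<Union>\<F>\<close> have KF: "K \<subseteq> (\<Union>x\<in>F. qball x (\<rho> x))"
    by simp
  \<comment> \<open>The extra 1 keeps the minimum defined and positive when \<open>F\<close> is
    empty, as it may be for empty \<open>K\<close>.\<close>
  define r where "r = Min (insert 1 (\<rho> ` F))"
  have "0 < r"
    using F \<rho>(1) by (auto simp: r_def)
  have r: "r \<le> \<rho> x" if "x \<in> F" for x
    using F(1) that by (auto simp: r_def)
  have "enlarge K r \<subseteq> U"
  proof
    fix z assume "z \<in> enlarge K r"
    then obtain y where y: "y \<in> K" "y \<in> M" "z \<in> M" "d y z < r"
      by (auto simp: mem_enlarge)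
    then obtain x where x: "x \<in> F" "x \<in> M" "d x y < \<rho> x"
      using KF by (auto simp: qball_def)
    have "d x z < 2 * \<rho> x"
      using triangle [of x y z] x y r [of x] by linarith
    then show "z \<in> U"
      using x y \<rho>(2) [of x] F(2) by (auto simp: qball_def)
  qed
  with \<open>0 < r\<close> show thesis by (rule that)
qed

lemma limitin_sym_dist:
  "limitin (Metric_space.mtopology M sym_dist) \<sigma> x F \<longleftrightarrow>
    x \<in> M \<and> (\<forall>\<epsilon>>0. \<forall>\<^sub>F n in F. \<sigma> n \<in> M \<and> d (\<sigma> n) x < \<epsilon> \<and> d x (\<sigma> n) < \<epsilon>)"
  using Metric_space.limitin_metric [OF Metric_space_sym_dist, of \<sigma> x F]
  by (simp add: sym_dist_def)

section \<open>Reduction of completeness to fast Cauchy sequences\<close>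

lemma qCauchy_fast_subsequence:
  assumes "qCauchy \<sigma>"
  obtains \<phi> where "strict_mono \<phi>"
    "\<And>n m. n \<le> m \<Longrightarrow> d (\<sigma> (\<phi> n)) (\<sigma> (\<phi> m)) < (1/2) ^ n"
proof -
  have "\<exists>N. \<forall>i j. N \<le> i \<longrightarrow> i \<le> j \<longrightarrow> d (\<sigma> i) (\<sigma> j) < (1/2) ^ n" for n
    using assms unfolding qCauchy_def by (meson half_gt_zero zero_less_one zero_less_power)
  then obtain N where N: "\<And>n i j. N n \<le> i \<Longrightarrow> i \<le> j \<Longrightarrow> d (\<sigma> i) (\<sigma> j) < (1/2) ^ n"
    by metis
  \<comment> \<open>Partial sums of positive terms increase strictly and dominate every single
    summand, so \<open>N n \<le> \<phi> n\<close> holds even if \<open>N\<close> is not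
    monotone.\<close>
  define \<phi> where "\<phi> n = (\<Sum>i\<le>n. Suc (N i))" for n
  have "strict_mono \<phi>"
    by (rule strict_mono_Suc_iff [THEN iffD2]) (simp add: \<phi>_def)
  moreover have "N n \<le> \<phi> n" for n
  proof -
    have "Suc (N n) \<le> \<phi> n"
      unfolding \<phi>_def by (rule member_le_sum) auto
    then show ?thesis by simp
  qed
  ultimately show thesis
    by (intro that [of \<phi>]) (auto intro!: N simp: strict_mono_less_eq)
qed

text \<open>A Cauchy sequence with a subsequence that converges in the symmetrized metric converges
  to the same limit, so it is enough to find limits of fast sequences.\<close>

lemma Smyth_complete_fast:
  assumes "\<And>\<sigma>. range \<sigma> \<subseteq> M \<Longrightarrow> (\<And>n m. n \<le> m \<Longrightarrow> d (\<sigma> n) (\<sigma> m) < (1/2) ^ n) \<Longrightarrow>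
    \<exists>x. limitin (Metric_space.mtopology M sym_dist) \<sigma> x sequentially"
  shows Smyth_complete
  unfolding Smyth_complete_def
proof (intro allI impI)
  fix \<sigma> assume \<sigma>: "qCauchy \<sigma>"
  then obtain \<phi> where \<phi>: "strict_mono \<phi>"
    "\<And>n m. n \<le> m \<Longrightarrow> d (\<sigma> (\<phi> n)) (\<sigma> (\<phi> m)) < (1/2) ^ n"
    using qCauchy_fast_subsequence by blast
  have M: "\<sigma> n \<in> M" for n
    using \<sigma> by (auto simp: qCauchy_def)
  obtain x where "limitin (Metric_space.mtopology M sym_dist) (\<sigma> \<circ> \<phi>) x sequentially"
    using assms [of "\<sigma> \<circ> \<phi>"] \<phi>(2) M by (auto simp: image_subset_iff)
  then have x: "x \<in> M" "\<And>\<epsilon>. \<epsilon> > 0 \<Longrightarrow>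
      \<forall>\<^sub>F n in sequentially. d (\<sigma> (\<phi> n)) x < \<epsilon> \<and> d x (\<sigma> (\<phi> n)) < \<epsilon>"
    by (auto simp: limitin_sym_dist M)
  have "\<forall>\<^sub>F n in sequentially. d (\<sigma> n) x < \<epsilon> \<and> d x (\<sigma> n) < \<epsilon>" if \<epsilon>: "\<epsilon> > 0" for \<epsilon>
  proof -
    obtain N where N: "\<And>n m. N \<le> n \<Longrightarrow> n \<le> m \<Longrightarrow> d (\<sigma> n) (\<sigma> m) < \<epsilon> / 2"
      using \<sigma> half_gt_zero [OF \<epsilon>] unfolding qCauchy_def by metis
    obtain N' where N': "\<And>n. N' \<le> n \<Longrightarrow> d (\<sigma> (\<phi> n)) x < \<epsilon> / 2 \<and> d x (\<sigma> (\<phi> n)) < \<epsilon> / 2"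
      using x(2) [of "\<epsilon> / 2"] \<epsilon> by (auto simp: eventually_sequentially)
    show ?thesis
      unfolding eventually_sequentially
    proof (intro exI allI impI)
      fix n assume n: "\<phi> (max N N') \<le> n"
      have \<phi>_ge: "k \<le> \<phi> k" for k
        using \<phi>(1) by (rule strict_mono_imp_increasing)
      \<comment> \<open>The Cauchy condition only bounds distances from earlier to later terms.
        Hence \<open>d (\<sigma> n) x\<close> is compared through a subsequence term not before
        \<open>n\<close>, and \<open>d x (\<sigma> n)\<close> through one not after
        \<open>n\<close>.\<close>
      have "d (\<sigma> n) (\<sigma> (\<phi> (max n N'))) < \<epsilon> / 2"
        by (rule N) (use n \<phi>_ge [of "max N N'"] \<phi>_ge [of "max n N'"] in linarith)+
      moreover have "d (\<sigma> (\<phi> (max n N'))) x < \<epsilon> / 2"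
        using N' by simp
      moreover have "d (\<sigma> (\<phi> (max N N'))) (\<sigma> n) < \<epsilon> / 2"
        by (rule N) (use n \<phi>_ge [of "max N N'"] in linarith)+
      moreover have "d x (\<sigma> (\<phi> (max N N'))) < \<epsilon> / 2"
        using N' by simp
      ultimately show "d (\<sigma> n) x < \<epsilon> \<and> d x (\<sigma> n) < \<epsilon>"
        using triangle [of "\<sigma> n" "\<sigma> (\<phi> (max n N'))" x] triangle [of x "\<sigma> (\<phi> (max N N'))" "\<sigma> n"] M x(1)
        by (smt (verit) field_sum_of_halves)
    qed
  qed
  then show "\<exists>x. limitin (Metric_space.mtopology M sym_dist) \<sigma> x sequentially"
    using M x(1) by (auto simp: limitin_sym_dist)
qed

subsection \<open>The upper Hausdorff quasi-metric\<close>

text \<open>The distance is truncated at \<open>1\<close>, which is the distance from \<open>{}\<close> to any nonempty set.\<close>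

definition upper_hausdorff :: "'a set \<Rightarrow> 'a set \<Rightarrow> real"
  where "upper_hausdorff K L = Inf (insert 1 {r. 0 < r \<and> L \<subseteq> enlarge K r})"

lemma bdd_below_upper_hausdorff: "bdd_below (insert 1 {r. 0 < r \<and> L \<subseteq> enlarge K r})"
  by (rule bdd_belowI [of _ 0]) auto

lemma upper_hausdorff_le: "0 < r \<Longrightarrow> L \<subseteq> enlarge K r \<Longrightarrow> upper_hausdorff K L \<le> r"
  unfolding upper_hausdorff_def using bdd_below_upper_hausdorff by (auto intro: cInf_lower)

lemma upper_hausdorff_le_1: "upper_hausdorff K L \<le> 1"
  unfolding upper_hausdorff_def using bdd_below_upper_hausdorff by (auto intro: cInf_lower)

text \<open>For \<open>r \<le> 1\<close> the truncation value 1 is not below \<open>r\<close>, so a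
  genuine enlargement radius witnesses the infimum. This is why later radii are cut down to
  \<open>min r 1\<close>.\<close>

lemma upper_hausdorff_less:
  assumes "upper_hausdorff K L < r" "r \<le> 1"
  shows "L \<subseteq> enlarge K r"
proof -
  obtain s where "s < r" "s = 1 \<or> (0 < s \<and> L \<subseteq> enlarge K s)"
    using assms(1) cInf_lessD [of "insert 1 {r. 0 < r \<and> L \<subseteq> enlarge K r}" r]
    unfolding upper_hausdorff_def by auto
  then show ?thesis
    using assms(2) enlarge_mono [of K K s r] by auto
qed

lemma upper_hausdorff_nonneg: "0 \<le> upper_hausdorff K L"
  unfolding upper_hausdorff_def by (rule cInf_greatest) auto

lemma upper_hausdorff_self:
  assumes "K \<subseteq> M"
  shows "upper_hausdorff K K = 0"
proof (rule antisym)
  show "upper_hausdorff K K \<le> 0"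
    by (rule field_le_epsilon) (simp add: assms upper_hausdorff_le subset_enlarge)
qed (rule upper_hausdorff_nonneg)

text \<open>Distance zero places \<open>L\<close> in all small enlargements of \<open>K\<close>. By
  compactness every open neighbourhood of \<open>K\<close> contains one of these, and by saturation
  \<open>K\<close> is the intersection of its open neighbourhoods.\<close>

lemma upper_hausdorff_eq_0D:
  assumes "K \<in> compact_saturated_sets qtopology" "L \<subseteq> M" "upper_hausdorff K L = 0"
  shows "L \<subseteq> K"
proof (rule saturatedin_subset)
  show "saturatedin qtopology K" "L \<subseteq> topspace qtopology"
    using assms by (auto simp: compact_saturated_sets_def)
next
  fix U assume "openin qtopology U" "K \<subseteq> U"
  moreover have "compactin qtopology K"
    using assms by (auto simp: compact_saturated_sets_def)
  ultimately obtain r where r: "0 < r" "enlarge K r \<subseteq> U"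
    using compactin_enlarge_subset by blast
  have "L \<subseteq> enlarge K (min r 1)"
    by (rule upper_hausdorff_less) (use assms r in auto)
  then show "L \<subseteq> U"
    using r enlarge_mono [of K K "min r 1" r] by auto
qed

text \<open>Radii add up when enlargements are iterated. The slack \<open>e / 2\<close> turns each
  infimum into a radius that is attained; if one of the radii exceeds 1, the truncation gives the
  bound.\<close>

lemma upper_hausdorff_triangle:
  "upper_hausdorff K N \<le> upper_hausdorff K L + upper_hausdorff L N"
proof (rule field_le_epsilon)
  fix e :: real assume "0 < e"
  define a where "a = upper_hausdorff K L + e / 2"
  define b where "b = upper_hausdorff L N + e / 2"
  have ab: "0 < a" "0 < b"
    using \<open>0 < e\<close> upper_hausdorff_nonneg [of K L] upper_hausdorff_nonneg [of L N]
    by (auto simp: a_def b_def)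
  have "upper_hausdorff K N \<le> a + b"
  proof (cases "a \<le> 1 \<and> b \<le> 1")
    case True
    have "L \<subseteq> enlarge K a" "N \<subseteq> enlarge L b"
      using True \<open>0 < e\<close> upper_hausdorff_less [of K L a] upper_hausdorff_less [of L N b]
      by (simp_all add: a_def b_def)
    then have "N \<subseteq> enlarge K (a + b)"
      using enlarge_mono [of L "enlarge K a" b b] enlarge_enlarge [of K a b] by blast
    then show ?thesis
      using ab by (intro upper_hausdorff_le) auto
  next
    case False
    then show ?thesis
      using upper_hausdorff_le_1 [of K N] ab by linarith
  qed
  then show "upper_hausdorff K N \<le> upper_hausdorff K L + upper_hausdorff L N + e"
    by (simp add: a_def b_def)
qed

lemma Quasi_metric_space_upper_hausdorff:
  "Quasi_metric_space (compact_saturated_sets qtopology) upper_hausdorff"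
proof
  fix K L
  assume KL: "K \<in> compact_saturated_sets qtopology" "L \<in> compact_saturated_sets qtopology"
  then have "K \<subseteq> M" "L \<subseteq> M"
    using compact_saturated_sets_subset_topspace by fastforce+
  with KL show "upper_hausdorff K L = 0 \<and> upper_hausdorff L K = 0 \<longleftrightarrow> K = L"
    using upper_hausdorff_eq_0D [of K L] upper_hausdorff_eq_0D [of L K] upper_hausdorff_self by blast
qed (simp_all add: upper_hausdorff_nonneg upper_hausdorff_triangle)

text \<open>The enlargements of a compact set form a base of its open neighbourhoods. Compactness
  turns boxes into neighbourhoods for the metric; openness of enlargements gives the
  converse.\<close>

lemma qtopology_upper_hausdorff:
  "Quasi_metric_space.qtopology (compact_saturated_sets qtopology) upper_hausdorff =
    upper_powerspace qtopology"
proof -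
  let ?C = "compact_saturated_sets qtopology"
  interpret H: Quasi_metric_space ?C upper_hausdorff
    by (rule Quasi_metric_space_upper_hausdorff)
  have "openin H.qtopology S" if S: "openin (upper_powerspace qtopology) S" for S
    unfolding H.openin_qtopology
  proof (intro conjI ballI)
    show "S \<subseteq> ?C"
      using S openin_subset by fastforce
    fix K assume "K \<in> S"
    then obtain U where U: "openin qtopology U" "K \<subseteq> U" "{L \<in> ?C. L \<subseteq> U} \<subseteq> S"
      using S unfolding openin_upper_powerspace by metis
    have "compactin qtopology K"
      using \<open>K \<in> S\<close> \<open>S \<subseteq> ?C\<close> by (auto simp: compact_saturated_sets_def)
    then obtain r where r: "0 < r" "enlarge K r \<subseteq> U"
      using U compactin_enlarge_subset by blast
    have "H.qball K (min r 1) \<subseteq> S"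
    proof
      fix L assume "L \<in> H.qball K (min r 1)"
      then have L: "L \<in> ?C" "upper_hausdorff K L < min r 1"
        by (auto simp: H.qball_def)
      have "L \<subseteq> enlarge K r"
        using upper_hausdorff_less [OF L(2)] enlarge_mono [of K K "min r 1" r] by auto
      then show "L \<in> S"
        using L(1) r(2) U(3) by blast
    qed
    then show "\<exists>r>0. H.qball K r \<subseteq> S"
      using r(1) by (intro exI [of _ "min r 1"]) auto
  qed
  moreover have "openin (upper_powerspace qtopology) S" if S: "openin H.qtopology S" for S
    unfolding openin_upper_powerspace
  proof (intro conjI ballI)
    show "S \<subseteq> ?C"
      using S H.openin_qtopology by blast
    fix K assume "K \<in> S"
    then obtain r where r: "0 < r" "H.qball K r \<subseteq> S"
      using S H.openin_qtopology by blast
    have K: "K \<in> ?C"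
      using \<open>K \<in> S\<close> \<open>S \<subseteq> ?C\<close> by auto
    \<comment> \<open>Halving the radius is needed because lying in an enlargement bounds the
      distance only weakly, while balls are strict.\<close>
    have "{L \<in> ?C. L \<subseteq> enlarge K (r / 2)} \<subseteq> H.qball K r"
    proof safe
      fix L assume "L \<in> ?C" "L \<subseteq> enlarge K (r / 2)"
      then show "L \<in> H.qball K r"
        using K r(1) upper_hausdorff_le [of "r / 2" L K] by (simp add: H.qball_def)
    qed
    then show "\<exists>U. openin qtopology U \<and> K \<subseteq> U \<and> {L \<in> ?C. L \<subseteq> U} \<subseteq> S"
      using r subset_enlarge [of K "r / 2"] compact_saturated_sets_subset_topspace [OF K]
      by (intro exI [of _ "enlarge K (r / 2)"]) (simp add: openin_enlarge)
  qed
  ultimately show ?thesis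
    unfolding topology_eq by blast
qed

subsection \<open>Smyth-completeness\<close>

lemma Smyth_completeD:
  assumes Smyth_complete "range \<sigma> \<subseteq> M" "\<And>n m. n \<le> m \<Longrightarrow> d (\<sigma> n) (\<sigma> m) \<le> C * (1/2) ^ n"
  obtains x where "x \<in> M"
    "\<And>\<epsilon>. 0 < \<epsilon> \<Longrightarrow> \<forall>\<^sub>F n in sequentially. d (\<sigma> n) x < \<epsilon> \<and> d x (\<sigma> n) < \<epsilon>"
proof -
  have "qCauchy \<sigma>"
    unfolding qCauchy_def
  proof (intro conjI allI impI)
    fix \<epsilon> :: real assume "0 < \<epsilon>"
    then have "\<forall>\<^sub>F n in sequentially. C * (1/2) ^ n < \<epsilon>"
      by (rule eventually_half_power_less)
    then show "\<exists>N. \<forall>n m. N \<le> n \<longrightarrow> n \<le> m \<longrightarrow> d (\<sigma> n) (\<sigma> m) < \<epsilon>"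
      using assms(3) unfolding eventually_sequentially by (meson le_less_trans)
  qed (rule assms(2))
  then obtain x where "limitin (Metric_space.mtopology M sym_dist) \<sigma> x sequentially"
    using assms(1) unfolding Smyth_complete_def by blast
  then have x: "x \<in> M" "\<And>\<epsilon>. 0 < \<epsilon> \<Longrightarrow>
      \<forall>\<^sub>F n in sequentially. \<sigma> n \<in> M \<and> d (\<sigma> n) x < \<epsilon> \<and> d x (\<sigma> n) < \<epsilon>"
    unfolding limitin_sym_dist by blast+
  show thesis
    by (rule that [OF x(1)], rule eventually_mono [OF x(2)]) auto
qed

text \<open>The bound telescopes, as \<open>2 * (1/2) ^ i\<close> equals
  \<open>4 * (1/2) ^ i - 4 * (1/2) ^ Suc i\<close>. The subtracted term is kept to pay for a last
  jump at level \<open>m\<close>.\<close>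

lemma chain_dist_le:
  assumes "\<And>i. i \<le> m \<Longrightarrow> c i \<in> M" "\<And>i. i < m \<Longrightarrow> d (c i) (c (Suc i)) < 2 * (1/2) ^ i" "n \<le> m"
  shows "d (c n) (c m) \<le> 4 * (1/2) ^ n - 4 * (1/2) ^ m"
  using \<open>n \<le> m\<close> assms(1,2)
proof (induction m rule: dec_induct)
  case base
  then show ?case by (simp add: refl)
next
  case (step m)
  have "d (c n) (c (Suc m)) \<le> d (c n) (c m) + d (c m) (c (Suc m))"
    using step.prems(1) step.hyps by (intro triangle) auto
  moreover have "d (c n) (c m) \<le> 4 * (1/2) ^ n - 4 * (1/2) ^ m"
    using step by auto
  moreover have "d (c m) (c (Suc m)) < 2 * (1/2) ^ m"
    using step.prems(2) by simp
  ultimately show ?case by simp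
qed

end

section \<open>Koenig's lemma for sequences of finite paths\<close>

text \<open>Row \<open>c m\<close> is a path of which only the entries up to \<open>m\<close> are
  controlled. Repeated use of the pigeonhole principle yields a branch each of whose prefixes is
  shared by infinitely many rows.\<close>

lemma infinite_branch_finite_levels:
  fixes c :: "nat \<Rightarrow> nat \<Rightarrow> 'a"
  assumes fin: "\<And>n. finite (F n)" and c: "\<And>m n. n \<le> m \<Longrightarrow> c m n \<in> F n"
  obtains x where "\<And>n. infinite {m. \<forall>i\<le>n. c m i = x i}"
proof -
  have pigeon: "\<exists>a. infinite {m \<in> S. c m n = a}" if "infinite S" for S :: "nat set" and n
  proof -
    \<comment> \<open>Rows with index below \<open>n\<close> are discarded, since their entry at
      level \<open>n\<close> need not lie in \<open>F n\<close>.\<close>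
    have "infinite (S - {..<n})"
      using that by simp
    moreover have "S - {..<n} = S \<inter> {n..}"
      by auto
    ultimately have "infinite (S \<inter> {n..})"
      by simp
    moreover have "(\<lambda>m. c m n) ` (S \<inter> {n..}) \<subseteq> F n"
      using c by auto
    ultimately obtain a where "infinite {m \<in> S \<inter> {n..}. c m n = a}"
      using pigeonhole_infinite [of "S \<inter> {n..}" "\<lambda>m. c m n"] finite_subset [OF _ fin] by blast
    moreover have "{m \<in> S \<inter> {n..}. c m n = a} \<subseteq> {m \<in> S. c m n = a}"
      by auto
    ultimately show ?thesis
      using infinite_super by blast
  qed
  define P where "P n y \<longleftrightarrow> infinite {m. \<forall>i\<le>n. c m i = y i}" for n and y :: "nat \<Rightarrow> 'a"
  obtain a where a: "infinite {m. c m 0 = a}"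
    using pigeon [of UNIV 0] by auto
  have "\<exists>f. \<forall>n. P n (f n) \<and> (\<forall>i\<le>n. f (Suc n) i = f n i)"
  proof (rule dependent_nat_choice)
    show "\<exists>y. P 0 y"
      using a by (intro exI [of _ "\<lambda>_. a"]) (simp add: P_def)
    fix y n assume "P n y"
    then obtain b where b: "infinite {m \<in> {m. \<forall>i\<le>n. c m i = y i}. c m (Suc n) = b}"
      using pigeon unfolding P_def by blast
    have "{m. \<forall>i\<le>Suc n. c m i = (y(Suc n := b)) i} =
        {m \<in> {m. \<forall>i\<le>n. c m i = y i}. c m (Suc n) = b}"
      by (auto simp: le_Suc_eq)
    with b show "\<exists>z. P (Suc n) z \<and> (\<forall>i\<le>n. z i = y i)"
      by (intro exI [of _ "y(Suc n := b)"]) (simp add: P_def)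
  qed
  then obtain f where f: "\<And>n. P n (f n)" "\<And>n i. i \<le> n \<Longrightarrow> f (Suc n) i = f n i"
    by blast
  \<comment> \<open>Later choices leave earlier entries fixed, so the diagonal of \<open>f\<close>
    is the branch.\<close>
  have stable: "f n i = f i i" if "i \<le> n" for n i
    using that by (induction n rule: dec_induct) (auto simp: f(2))
  show thesis
  proof
    fix n
    have "{m. \<forall>i\<le>n. c m i = f n i} = {m. \<forall>i\<le>n. c m i = f i i}"
      using stable [of _ n] by (intro Collect_cong) metis
    then show "infinite {m. \<forall>i\<le>n. c m i = f i i}"
      using f(1) [of n] by (simp add: P_def)
  qed
qed

section \<open>Compactness and convergence of the limit set\<close>

context Quasi_metric_space
begin

text \<open>Chain steps from level \<open>n\<close> on add up to at most
  \<open>4 * (1/2) ^ n\<close>, and the constant 5 leaves room for one more jump. Both directions of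
  symmetrized convergence are used: small \<open>d (x n) p\<close> puts the limit into every
  enlargement, small \<open>d p (x n)\<close> brings points \<open>y m\<close> into a ball around
  it.\<close>

lemma open_cover_contains_enlargement:
  assumes complete: Smyth_complete
    and fin: "\<And>n. finite (F n)" and FM: "\<And>n. F n \<subseteq> M"
    and step: "\<And>n. F (Suc n) \<subseteq> enlarge (F n) (2 * (1/2) ^ n)"
    and W: "\<And>n. openin qtopology (W n)" "\<And>n m. n \<le> m \<Longrightarrow> W n \<subseteq> W m"
    and cover: "(\<Inter>n. enlarge (F n) (5 * (1/2) ^ n)) \<subseteq> (\<Union>n. W n)"
  obtains n where "enlarge (F n) (5 * (1/2) ^ n) \<subseteq> W n"
proof (rule ccontr)
  assume "\<not> thesis"
  then have "\<forall>n. \<exists>y. y \<in> enlarge (F n) (5 * (1/2) ^ n) \<and> y \<notin> W n"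
    using that by blast
  then obtain y where y: "\<And>n. y n \<in> enlarge (F n) (5 * (1/2) ^ n)" "\<And>n. y n \<notin> W n"
    by metis
  then have yM: "y n \<in> M" for n
    by (auto simp: mem_enlarge)
  have chain: "\<exists>c. c m = z \<and> (\<forall>i\<le>m. c i \<in> F i) \<and> (\<forall>i<m. d (c i) (c (Suc i)) < 2 * (1/2) ^ i)"
    if "z \<in> F m" for m z
    using that
  proof (induction m arbitrary: z)
    case 0
    then show ?case by (intro exI [of _ "\<lambda>_. z"]) auto
  next
    case (Suc m)
    have "z \<in> enlarge (F m) (2 * (1/2) ^ m)"
      using Suc.prems step by blast
    then obtain w where w: "w \<in> F m" "d w z < 2 * (1/2) ^ m"
      unfolding mem_enlarge by blast
    then obtain c where "c m = w" "\<forall>i\<le>m. c i \<in> F i" "\<forall>i<m. d (c i) (c (Suc i)) < 2 * (1/2) ^ i"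
      using Suc.IH by blast
    then show ?case
      using w Suc.prems by (intro exI [of _ "c(Suc m := z)"]) (auto simp: le_Suc_eq less_Suc_eq)
  qed
  have "\<forall>m. \<exists>c. d (c m) (y m) < 5 * (1/2) ^ m \<and> (\<forall>i\<le>m. c i \<in> F i) \<and>
      (\<forall>i<m. d (c i) (c (Suc i)) < 2 * (1/2) ^ i)"
    using y(1) chain unfolding mem_enlarge by metis
  then obtain c where c: "\<And>m. d (c m m) (y m) < 5 * (1/2) ^ m" "\<And>m i. i \<le> m \<Longrightarrow> c m i \<in> F i"
    "\<And>m i. i < m \<Longrightarrow> d (c m i) (c m (Suc i)) < 2 * (1/2) ^ i"
    by metis
  \<comment> \<open>The telescoped bound plus the last jump is below
    \<open>4 * (1/2) ^ n + (1/2) ^ m\<close>, which is at most \<open>5 * (1/2) ^ n\<close>.\<close>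
  have dcy: "d (c m n) (y m) < 5 * (1/2) ^ n" if "n \<le> m" for n m
  proof -
    have "d (c m n) (c m m) \<le> 4 * (1/2) ^ n - 4 * (1/2) ^ m"
      using c(2,3) FM that by (intro chain_dist_le) blast+
    moreover have "(1/2 :: real) ^ m \<le> (1/2) ^ n"
      using that by (intro power_decreasing) auto
    moreover have "d (c m n) (y m) \<le> d (c m n) (c m m) + d (c m m) (y m)"
      using c(2) FM that yM by (intro triangle) blast+
    ultimately show ?thesis
      using c(1) [of m] by linarith
  qed
  obtain x where x: "\<And>n. infinite {m. \<forall>i\<le>n. c m i = x i}"
    using infinite_branch_finite_levels [of F c] fin c(2) by blast
  have late: "\<exists>m\<ge>k. \<forall>i\<le>n. c m i = x i" for n k
    using x [of n] unfolding infinite_nat_iff_unbounded_le by auto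
  have xF: "x n \<in> F n" for n
    using late [of n n] c(2) by (metis order_refl)
  \<comment> \<open>Some row with index beyond \<open>n\<close> agrees with the branch up to
    \<open>Suc n\<close>, and its step bound carries over.\<close>
  have "d (x n) (x (Suc n)) < 2 * (1/2) ^ n" for n
    using late [of "Suc n" "Suc n"] c(3) by (metis Suc_le_lessD le_Suc_eq order_refl)
  then have dx: "d (x n) (x m) \<le> 4 * (1/2) ^ n - 4 * (1/2) ^ m" if "n \<le> m" for n m
    using xF FM that by (intro chain_dist_le) blast+
  have "d (x n) (x m) \<le> 4 * (1/2) ^ n" if "n \<le> m" for n m
    using dx [OF that] by (smt (verit) zero_le_power divide_nonneg_nonneg)
  moreover have "range x \<subseteq> M"
    using xF FM by blast
  ultimately obtain p where p: "p \<in> M"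
    "\<And>\<epsilon>. 0 < \<epsilon> \<Longrightarrow> \<forall>\<^sub>F n in sequentially. d (x n) p < \<epsilon> \<and> d p (x n) < \<epsilon>"
    using Smyth_completeD [OF complete] by blast
  have "p \<in> enlarge (F n) (5 * (1/2) ^ n)" for n
  proof -
    have "\<forall>\<^sub>F m in sequentially. d (x m) p < (1/2) ^ n \<and> n \<le> m"
      using p(2) [of "(1/2) ^ n"] eventually_ge_at_top [of n] by (simp add: eventually_conj_iff)
    then obtain m where "d (x m) p < (1/2) ^ n" "n \<le> m"
      by (auto dest: eventually_happens)
    moreover have "d (x n) (x m) \<le> 4 * (1/2) ^ n"
      using \<open>\<And>n m. n \<le> m \<Longrightarrow> d (x n) (x m) \<le> 4 * (1/2) ^ n\<close> \<open>n \<le> m\<close> .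
    moreover have "d (x n) p \<le> d (x n) (x m) + d (x m) p"
      using xF FM p(1) by (intro triangle) blast+
    ultimately show ?thesis
      using xF FM p(1) unfolding mem_enlarge by (intro bexI [of _ "x n"]) auto
  qed
  then obtain j where "p \<in> W j"
    using cover by blast
  then obtain r where r: "0 < r" "qball p r \<subseteq> W j"
    using W(1) openin_qtopology by meson
  have "\<forall>\<^sub>F n in sequentially. d p (x n) < r / 2 \<and> 5 * (1/2) ^ n < r / 2"
    using p(2) [of "r / 2"] eventually_half_power_less [of "r / 2" 5] r(1)
    by (simp add: eventually_conj_iff)
  then obtain n where n: "d p (x n) < r / 2" "5 * (1/2) ^ n < r / 2"
    by (auto dest: eventually_happens)
  \<comment> \<open>Here \<open>n \<le> m\<close> makes \<open>y m\<close> close to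
    \<open>x n\<close>, and \<open>j \<le> m\<close> carries membership in \<open>W j\<close> over
    to \<open>W m\<close>, which \<open>y m\<close> avoids.\<close>
  obtain m where m: "max n j \<le> m" "c m n = x n"
    using late [of "max n j" n] by blast
  have "d p (y m) \<le> d p (x n) + d (x n) (y m)"
    using xF FM p(1) yM by (intro triangle) blast+
  moreover have "d (x n) (y m) < 5 * (1/2) ^ n"
    using dcy [of n m] m by simp
  ultimately have "y m \<in> qball p r"
    using n p(1) yM by (simp add: qball_def)
  then have "y m \<in> W m"
    using r(2) W(2) [of j m] m(1) by auto
  with y(2) show False by blast
qed

text \<open>Second countability enters through the Lindelof property: a countable subcover has
  increasing finite unions, the form of cover to which the Koenig argument applies.\<close>

lemma Smyth_complete_upper_hausdorff:
  assumes complete: Smyth_complete and sc: "second_countable qtopology"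
  shows "Quasi_metric_space.Smyth_complete (compact_saturated_sets qtopology) upper_hausdorff"
proof -
  let ?C = "compact_saturated_sets qtopology"
  interpret H: Quasi_metric_space ?C upper_hausdorff
    by (rule Quasi_metric_space_upper_hausdorff)
  show ?thesis
  proof (rule H.Smyth_complete_fast)
    fix K :: "nat \<Rightarrow> 'a set"
    assume KC: "range K \<subseteq> ?C"
      and fast: "\<And>n m. n \<le> m \<Longrightarrow> upper_hausdorff (K n) (K m) < (1/2) ^ n"
    have KM: "K n \<subseteq> M" for n
      using KC compact_saturated_sets_subset_topspace [of "K n" qtopology] by auto
    have K_sub: "K m \<subseteq> enlarge (K n) ((1/2) ^ n)" if "n \<le> m" for n m
      using fast [OF that] by (rule upper_hausdorff_less) (simp add: power_le_one)
    have "\<exists>F. finite F \<and> F \<subseteq> K n \<and> K n \<subseteq> enlarge F ((1/2) ^ n)" for n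
    proof -
      have "compactin qtopology (K n)"
        using KC by (auto simp: compact_saturated_sets_def)
      then show ?thesis
        using compactin_finite_net [of "K n" "(1/2) ^ n"] by (metis half_gt_zero zero_less_one zero_less_power)
    qed
    then obtain F where F: "\<And>n. finite (F n)" "\<And>n. F n \<subseteq> K n"
      "\<And>n. K n \<subseteq> enlarge (F n) ((1/2) ^ n)"
      by metis
    have FM: "F n \<subseteq> M" for n
      using F(2) KM by blast
    \<comment> \<open>One \<open>(1/2) ^ n\<close> leads from the net to \<open>K n\<close>, the
      other from \<open>K n\<close> to \<open>K m\<close>.\<close>
    have K_net: "K m \<subseteq> enlarge (F n) (2 * (1/2) ^ n)" if "n \<le> m" for n m
      using K_sub [OF that] enlarge_mono [OF F(3) order_refl, of n "(1/2) ^ n"]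
        enlarge_enlarge [of "F n" "(1/2) ^ n" "(1/2) ^ n"] by auto
    define V where "V n = enlarge (F n) (5 * (1/2) ^ n)" for n
    have V_open: "openin qtopology (V n)" for n
      by (simp add: V_def openin_enlarge)
    have K_V: "K m \<subseteq> V n" if "n \<le> m" for n m
      using K_net [OF that] enlarge_mono [of "F n" "F n" "2 * (1/2) ^ n" "5 * (1/2) ^ n"]
      by (auto simp: V_def)
    define L where "L = (\<Inter>n. V n)"
    have key: "\<exists>n. V n \<subseteq> W n"
      if W: "\<And>n. openin qtopology (W n)" "\<And>n m. n \<le> m \<Longrightarrow> W n \<subseteq> W m" "L \<subseteq> (\<Union>n. W n)" for W
    proof -
      have step: "F (Suc n) \<subseteq> enlarge (F n) (2 * (1/2) ^ n)" for n
        using F(2) [of "Suc n"] K_net [of n "Suc n"] by auto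
      have "(\<Inter>n. enlarge (F n) (5 * (1/2) ^ n)) \<subseteq> (\<Union>n. W n)"
        using W(3) by (simp add: L_def V_def)
      then obtain n where "enlarge (F n) (5 * (1/2) ^ n) \<subseteq> W n"
        using open_cover_contains_enlargement [of F W, OF complete F(1) FM step W(1)] W(2) by blast
      then show ?thesis
        by (auto simp: V_def)
    qed
    have LM: "L \<subseteq> M"
      using V_open openin_subset by (fastforce simp: L_def)
    have "compactin qtopology L"
      unfolding compactin_def
    proof (intro conjI allI impI)
      fix \<U> assume \<U>: "Ball \<U> (openin qtopology) \<and> L \<subseteq> \<Union>\<U>"
      have "Lindelof_space (subtopology qtopology L)"
        using sc by (simp add: second_countable_imp_Lindelof_space second_countable_subtopology)
      then obtain \<V> where \<V>: "countable \<V>" "\<V> \<subseteq> \<U>" "L \<subseteq> \<Union>\<V>"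
        using \<U> LM unfolding Lindelof_space_subtopology_subset [of L qtopology, simplified, OF LM]
        by metis
      show "\<exists>\<F>. finite \<F> \<and> \<F> \<subseteq> \<U> \<and> L \<subseteq> \<Union>\<F>"
      \<comment> \<open>The empty subcover is set apart because \<open>from_nat_into\<close>
        enumerates only nonempty sets.\<close>
      proof (cases "\<V> = {}")
        case True
        then show ?thesis using \<V> by (intro exI [of _ "{}"]) auto
      next
        case False
        define W where "W n = (\<Union>i\<le>n. from_nat_into \<V> i)" for n
        have in_\<V>: "from_nat_into \<V> i \<in> \<V>" for i
          using False by (rule from_nat_into)
        have "openin qtopology (W n)" for n
          using in_\<V> \<V>(2) \<U> by (auto simp: W_def)
        moreover have "W n \<subseteq> W m" if "n \<le> m" for n m
          using that by (force simp: W_def)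
        moreover have "L \<subseteq> (\<Union>n. W n)"
        proof -
          have "\<Union>\<V> = (\<Union>i. from_nat_into \<V> i)"
            using range_from_nat_into [OF False \<V>(1)] by simp
          also have "\<dots> \<subseteq> (\<Union>n. W n)"
            unfolding W_def by (intro SUP_mono) auto
          finally show ?thesis
            using \<V>(3) by (rule order_trans [rotated])
        qed
        ultimately obtain n where "V n \<subseteq> W n"
          using key by blast
        then have "L \<subseteq> \<Union>(from_nat_into \<V> ` {..n})"
          by (auto simp: L_def W_def)
        then show ?thesis
          using in_\<V> \<V>(2) by (intro exI [of _ "from_nat_into \<V> ` {..n}"]) auto
      qed
    qed (use LM in simp)
    moreover have "saturatedin qtopology L"
      unfolding L_def by (rule saturatedin_Inter) (auto simp: V_open)
    ultimately have LC: "L \<in> ?C"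
      by (simp add: compact_saturated_sets_def)
    have "\<forall>\<^sub>F n in sequentially. K n \<in> ?C \<and> upper_hausdorff (K n) L < \<epsilon> \<and> upper_hausdorff L (K n) < \<epsilon>"
      if \<epsilon>: "0 < \<epsilon>" for \<epsilon>
    proof -
      have "\<forall>\<^sub>F n in sequentially. 5 * (1/2) ^ n < \<epsilon>"
        using \<epsilon> by (rule eventually_half_power_less)
      \<comment> \<open>The net \<open>F n\<close> consists of points of \<open>K n\<close>, so
        \<open>V n\<close>, and with it \<open>L\<close>, lies in an enlargement of
        \<open>K n\<close>.\<close>
      moreover have "upper_hausdorff (K n) L \<le> 5 * (1/2) ^ n" for n
      proof (rule upper_hausdorff_le)
        show "L \<subseteq> enlarge (K n) (5 * (1/2) ^ n)"
          using enlarge_mono [OF F(2) order_refl, of n "5 * (1/2) ^ n"] by (auto simp: L_def V_def)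
      qed simp
      ultimately have 1: "\<forall>\<^sub>F n in sequentially. upper_hausdorff (K n) L < \<epsilon>"
        by (auto elim!: eventually_mono intro: le_less_trans)
      \<comment> \<open>A constant sequence of open sets already covering \<open>L\<close> is used;
        the resulting \<open>V k\<close> contains all \<open>K n\<close> with
        \<open>k \<le> n\<close>.\<close>
      obtain k where k: "V k \<subseteq> enlarge L (\<epsilon> / 2)"
        using key [of "\<lambda>_. enlarge L (\<epsilon> / 2)"] openin_enlarge subset_enlarge [OF LM, of "\<epsilon> / 2"] \<epsilon>
        by auto
      have "upper_hausdorff L (K n) < \<epsilon>" if "k \<le> n" for n
        using upper_hausdorff_le [OF _ subset_trans [OF K_V [OF that] k]] \<epsilon> by simp
      then have 2: "\<forall>\<^sub>F n in sequentially. upper_hausdorff L (K n) < \<epsilon>"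
        by (auto simp: eventually_sequentially)
      show ?thesis
        using 1 2 KC by (auto simp: eventually_conj_iff image_subset_iff)
    qed
    then show "\<exists>L. limitin (Metric_space.mtopology ?C H.sym_dist) K L sequentially"
      using LC by (auto simp: H.limitin_sym_dist)
  qed
qed

end

theorem theorem4p5:
  fixes X :: "'a topology"
  assumes "quasi_Polish_space X"
  shows "quasi_Polish_space (upper_powerspace X)"
proof -
  obtain d where d: "second_countable X" "Quasi_metric_space (topspace X) d"
    "Quasi_metric_space.qtopology (topspace X) d = X"
    "Quasi_metric_space.Smyth_complete (topspace X) d"
    using assms unfolding quasi_Polish_space_def by blast
  interpret Quasi_metric_space "topspace X" d
    by (rule d(2))
  show ?thesis
    unfolding quasi_Polish_space_def topspace_upper_powerspace
    using second_countable_upper_powerspace [OF d(1)] Quasi_metric_space_upper_hausdorff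
      qtopology_upper_hausdorff Smyth_complete_upper_hausdorff [OF d(4)] d(1)
    unfolding d(3) by blast
qed

end
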